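(* Let $q=\prod_i q_i$ be a (finite) product, where every $q_i$ is a prime power congruent to $1$ modulo $6$. Then there exists a CO$(q)$ (cubic orthomorphism of order $q$).
   Context: Cubic orthomorphism. Let $q\equiv1\pmod 6$ be a positive integer. A cubic orthomorphism of order $q$, CO$(q)$, is a triple $(G,f,G^+)$, where $G$ is an abelian group (written additively) of order $q$, $f$ is a permutation of $G$, and $G^+\subseteq G$ is such that $G$ is the disjoint union of $\{0\}$, $G^+$ and $-G^+$, satisfying: (1) the map $a\mapsto f(a)-a$ is a bijection of $G$; (2) $f(-a)=-f(a)$ for every $a\in G$ (in particular $f(0)=0$); (3) $f$ has cycle type $1^1 3^{(q-1)/3}$ (i.e. $0$ is the only fixed point and all other cycles have length $3$); (4) $f(G^+)=G^+$; (5) $a+f(a)+f^2(a)=0$ for every $a\in G$; (6) for every $b\in G$, the map $a\mapsto f^2(a)+f(b-a)$ is a bijection of $G$; (7) for every $b\in G$, the two sets $\{a+f(b)-f(a+b):a\in G^+\}$ and $\{f^2(a)+f(b)-f(a+b):a\in G^+\}$ form a partition of $G\setminus\{0\}$. Here $f^2(a)=f(f(a))$. *)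

theory Defs
  imports
    "HOL-Algebra.Algebra"
    "HOL-Combinatorics.Orbits"
    "HOL-Library.Multiset"
    "HOL-Number_Theory.Cong"
    "HOL-Number_Theory.Prime_Powers"
begin

text \<open>
  The multiset of cycle lengths of a permutation \<open>f\<close> of a finite set \<open>A\<close>, fixed points included
  as cycles of length 1. The cycle through \<open>a\<close> is \<open>orbit f a = {f a, f (f a), \<dots>}\<close>, which
  contains \<open>a\<close> because \<open>f\<close> permutes the finite set \<open>A\<close>.
\<close>
definition cycle_type :: "('a \<Rightarrow> 'a) \<Rightarrow> 'a set \<Rightarrow> nat multiset" where
  "cycle_type f A = image_mset card (mset_set (orbit f ` A))"

text \<open>
  The abelian group is a \<^locale>\<open>comm_group\<close>, whose notation is multiplicative:
  \<open>\<one>\<close>, \<open>a \<otimes> b\<close>, \<open>inv a\<close> stand for 0, \<open>a + b\<close>, \<open>- a\<close>. The values of \<open>f\<close> outside the carrier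
  are irrelevant. A partition into two sets is read as a disjoint union in which empty parts are
  allowed; this only matters for \<open>q = 1\<close>. In \<open>cycle_type\<close>, the unique fixed point is
  necessarily \<open>\<one>\<close>, since \<open>f_inv\<close> and the oddness of \<open>q\<close> give \<open>f \<one> = \<one>\<close>.
\<close>
locale cubic_orthomorphism = comm_group G for G (structure) +
  fixes q :: nat and f :: "'a \<Rightarrow> 'a" and Gplus :: "'a set"
  assumes q_cong: "[q = 1] (mod 6)"
    and order_eq: "order G = q"
    and f_perm: "bij_betw f (carrier G) (carrier G)"
    and Gplus_subset: "Gplus \<subseteq> carrier G"
    and carrier_split: "carrier G = {\<one>} \<union> Gplus \<union> (\<lambda>a. inv a) ` Gplus"
    and carrier_split_disjoint:
      "\<one> \<notin> Gplus" "\<one> \<notin> (\<lambda>a. inv a) ` Gplus" "Gplus \<inter> (\<lambda>a. inv a) ` Gplus = {}"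
    and orthomorphism: "bij_betw (\<lambda>a. f a \<otimes> inv a) (carrier G) (carrier G)"
    and f_inv: "\<And>a. a \<in> carrier G \<Longrightarrow> f (inv a) = inv (f a)"
    and f_cycle_type: "cycle_type f (carrier G) = {#1#} + replicate_mset ((q - 1) div 3) 3"
    and f_Gplus: "f ` Gplus = Gplus"
    and cubic: "\<And>a. a \<in> carrier G \<Longrightarrow> a \<otimes> f a \<otimes> f (f a) = \<one>"
    and bij_shift: "\<And>b. b \<in> carrier G \<Longrightarrow>
      bij_betw (\<lambda>a. f (f a) \<otimes> f (b \<otimes> inv a)) (carrier G) (carrier G)"
    and partition_Un: "\<And>b. b \<in> carrier G \<Longrightarrow>
      (\<lambda>a. a \<otimes> f b \<otimes> inv (f (a \<otimes> b))) ` Gplus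
        \<union> (\<lambda>a. f (f a) \<otimes> f b \<otimes> inv (f (a \<otimes> b))) ` Gplus = carrier G - {\<one>}"
    and partition_disjoint: "\<And>b. b \<in> carrier G \<Longrightarrow>
      (\<lambda>a. a \<otimes> f b \<otimes> inv (f (a \<otimes> b))) ` Gplus
        \<inter> (\<lambda>a. f (f a) \<otimes> f b \<otimes> inv (f (a \<otimes> b))) ` Gplus = {}"

end

theory Submission
  imports Defs "HOL-Number_Theory.Residue_Primitive_Roots"
begin

text \<open>
  Let \<open>\<phi>\<close> be an endomorphism of an abelian group \<open>G\<close> with \<open>1 + \<phi> + \<phi>\<^sup>2 = 0\<close>, so that \<open>G\<close> is a
  module over the Eisenstein integers. If the order of \<open>G\<close> is prime to 6, then \<open>\<phi> - 1\<close> is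
  bijective (a fixed point \<open>a\<close> satisfies \<open>3 a = 0\<close>) and the group generated by \<open>- \<phi>\<close> acts freely
  on \<open>G - {0}\<close>. Hence \<open>G - {0}\<close> splits into a \<open>\<phi>\<close>-invariant set and its negative, and \<open>\<phi>\<close> is a
  cubic orthomorphism; in condition (7) the two sets are the images of \<open>- G\<^sup>+\<close> and \<open>G\<^sup>+\<close> under
  \<open>\<phi> - 1\<close>. Modules of this kind are closed under products. They exist with order \<open>p\<close> for every
  prime \<open>p \<equiv> 1 (mod 3)\<close>, because \<open>\<int>/p\<close> contains a primitive cube root of unity, and with
  order \<open>n\<^sup>2\<close> for every \<open>n\<close>, by extension of scalars from \<open>\<int>/n\<close>.
\<close>

section \<open>Abelian groups with an endomorphism \<phi> satisfying 1 + \<phi> + \<phi>^2 =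
  0\<close>

locale eisenstein_group = comm_group G for G (structure) +
  fixes \<phi> :: "'a \<Rightarrow> 'a"
  assumes hom: "\<phi> \<in> hom G G"
    and cyclotomic: "a \<in> carrier G \<Longrightarrow> a \<otimes> \<phi> a \<otimes> \<phi> (\<phi> a) = \<one>"
begin

lemma closed [simp, intro]: "a \<in> carrier G \<Longrightarrow> \<phi> a \<in> carrier G"
  using hom by (auto simp: hom_def)

lemma mult: "a \<in> carrier G \<Longrightarrow> b \<in> carrier G \<Longrightarrow> \<phi> (a \<otimes> b) = \<phi> a \<otimes> \<phi> b"
  using hom by (auto simp: hom_def)

lemma one [simp]: "\<phi> \<one> = \<one>"
  using hom_one[OF hom is_group is_group] .

lemma inv: "a \<in> carrier G \<Longrightarrow> \<phi> (inv a) = inv (\<phi> a)"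
  using group_hom.hom_inv[OF group_hom.intro[OF is_group is_group]] hom
  by (simp add: group_hom_axioms_def)

text \<open>The cyclotomic relations for \<open>a\<close> and for \<open>\<phi> a\<close> share the
  terms \<open>\<phi> a\<close> and \<open>\<phi> (\<phi> a)\<close>; cancelling these leaves the
  claim. This is the divisibility of X^3 - 1 by X^2 + X + 1.\<close>

lemma cube [simp]:
  assumes "a \<in> carrier G"
  shows "\<phi> (\<phi> (\<phi> a)) = a"
proof -
  have "\<phi> a \<otimes> \<phi> (\<phi> a) \<otimes> a = \<one>"
    using cyclotomic[OF assms] assms by (simp add: m_ac)
  also have "\<dots> = \<phi> a \<otimes> \<phi> (\<phi> a) \<otimes> \<phi> (\<phi> (\<phi> a))"
    using cyclotomic[of "\<phi> a"] assms by simp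
  finally show ?thesis
    using assms by simp
qed

lemma eq_one_iff [simp]: "a \<in> carrier G \<Longrightarrow> \<phi> a = \<one> \<longleftrightarrow> a = \<one>"
  by (metis cube one)

lemma bij: "bij_betw \<phi> (carrier G) (carrier G)"
  by (rule bij_betw_byWitness[where f' = "\<lambda>a. \<phi> (\<phi> a)"]) auto

lemma orbit_eq:
  assumes "a \<in> carrier G"
  shows "orbit \<phi> a = {a, \<phi> a, \<phi> (\<phi> a)}"
proof
  show "orbit \<phi> a \<subseteq> {a, \<phi> a, \<phi> (\<phi> a)}"
  proof
    fix y assume "y \<in> orbit \<phi> a"
    then show "y \<in> {a, \<phi> a, \<phi> (\<phi> a)}"
      by induction (use assms in auto)
  qed
  have "\<phi> (\<phi> (\<phi> a)) \<in> orbit \<phi> a"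
    by (intro orbit.intros)
  then show "{a, \<phi> a, \<phi> (\<phi> a)} \<subseteq> orbit \<phi> a"
    using assms by (auto intro: orbit.intros)
qed

lemma orbit_cyclic:
  "a \<in> carrier G \<Longrightarrow> y \<in> orbit \<phi> a \<Longrightarrow> orbit \<phi> y = orbit \<phi> a"
  by (auto simp: orbit_eq)

end

section \<open>Order prime to 6: fixed points, the map \<phi> - 1 and half-systems\<close>

lemma (in group) pow_eq_one_coprime:
  assumes "a \<in> carrier G" "a [^] (n::nat) = \<one>" "coprime n (order G)"
  shows "a = \<one>"
proof -
  have "ord a dvd n" "ord a dvd order G"
    using assms pow_eq_id ord_dvd_group_order by auto
  then have "ord a = 1"
    using assms(3) coprime_common_divisor_nat by blast
  then show ?thesis
    using assms(1) ord_eq_1 by blast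
qed

text \<open>Used with \<open>y\<close> = \<open>\<phi> b\<close> to remove \<open>b\<close> from the
  differences in the partition condition.\<close>

lemma (in group) mult_inv_mult_cancel:
  assumes "x \<in> carrier G" "y \<in> carrier G" "z \<in> carrier G"
  shows "x \<otimes> y \<otimes> inv (z \<otimes> y) = x \<otimes> inv z"
proof -
  have "y \<otimes> (inv y \<otimes> inv z) = inv z"
    using assms by (simp flip: m_assoc)
  then show ?thesis
    using assms by (simp add: inv_mult_group m_assoc)
qed

locale eisenstein_group_coprime_6 = eisenstein_group +
  assumes coprime_6: "coprime 6 (order G)"
begin

lemma finite_carrier: "finite (carrier G)"
proof (rule ccontr)
  assume "infinite (carrier G)"
  \<comment> \<open>An infinite carrier has cardinality 0 by convention, and 0 is not coprime to
    6.\<close>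
  then have "order G = 0"
    by (simp add: order_def)
  then show False
    using coprime_6 by simp
qed

lemma coprime_2: "coprime 2 (order G)" and coprime_3: "coprime 3 (order G)"
  using coprime_6 coprime_mult_left_iff[of 2 3 "order G"] by auto

lemma eq_imp_one:
  assumes "a \<in> carrier G" "\<phi> a = a"
  shows "a = \<one>"
proof (rule pow_eq_one_coprime[OF assms(1) _ coprime_3])
  show "a [^] (3::nat) = \<one>"
    using cyclotomic[OF assms(1)] assms by (simp add: numeral_3_eq_3)
qed

text \<open>This is what allows a cycle of \<phi> to be put on one side of a half-system. If
  \<open>a\<close> is its own inverse, its order divides 2. If \<open>inv a\<close> is
  \<open>\<phi> a\<close> or \<open>\<phi> (\<phi> a)\<close>, two terms of the cyclotomic relation
  cancel and the remaining one is trivial.\<close>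

lemma eq_inv_imp_one:
  assumes "a \<in> carrier G" "inv a \<in> {a, \<phi> a, \<phi> (\<phi> a)}"
  shows "a = \<one>"
proof -
  consider "inv a = a" | "\<phi> a = inv a" | "\<phi> (\<phi> a) = inv a"
    using assms(2) by auto
  then show ?thesis
  proof cases
    case 1
    then have "a [^] (2::nat) = \<one>"
      using assms(1) r_inv[of a] by (simp add: numeral_2_eq_2)
    then show ?thesis
      using pow_eq_one_coprime assms(1) coprime_2 by blast
  next
    case 2
    then have "\<phi> (\<phi> a) = \<one>"
      using cyclotomic[OF assms(1)] assms(1) by simp
    then show ?thesis
      using assms(1) by simp
  next
    case 3
    have "a \<otimes> \<phi> a \<otimes> \<phi> (\<phi> a) = \<phi> a"
      using 3 assms(1) by (simp add: m_assoc m_lcomm[of a "\<phi> a" "inv a"])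
    then have "\<phi> a = \<one>"
      using cyclotomic[OF assms(1)] by simp
    then show ?thesis
      using assms(1) by simp
  qed
qed

text \<open>The endomorphism \<phi> - 1, whose bijectivity is the orthomorphism condition and which
  also governs the shift and partition conditions.\<close>

definition \<delta> :: "'a \<Rightarrow> 'a" where
  "\<delta> a = \<phi> a \<otimes> inv a"

lemma delta_closed [simp, intro]: "a \<in> carrier G \<Longrightarrow> \<delta> a \<in> carrier G"
  by (simp add: \<delta>_def)

lemma delta_mult: "a \<in> carrier G \<Longrightarrow> b \<in> carrier G \<Longrightarrow> \<delta> (a \<otimes> b) = \<delta> a \<otimes> \<delta> b"
  by (simp add: \<delta>_def mult inv_mult m_ac)

lemma delta_one [simp]: "\<delta> \<one> = \<one>"
  by (simp add: \<delta>_def)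

lemma delta_inv: "a \<in> carrier G \<Longrightarrow> \<delta> (inv a) = inv (\<delta> a)"
  by (simp add: \<delta>_def inv inv_mult)

text \<open>The kernel of \<delta> consists of the fixed points of \<phi>, and only the identity is
  fixed.\<close>

lemma delta_inj: "inj_on \<delta> (carrier G)"
proof (rule inj_onI)
  fix a b assume ab: "a \<in> carrier G" "b \<in> carrier G" "\<delta> a = \<delta> b"
  define c where "c = a \<otimes> inv b"
  have c: "c \<in> carrier G"
    using ab by (simp add: c_def)
  have "\<delta> c = \<one>"
    using ab by (simp add: c_def delta_mult delta_inv)
  then have "\<phi> c = c"
    using c inv_equality[of "\<phi> c" "inv c"] by (simp add: \<delta>_def)
  then have "c = \<one>"
    using c by (rule eq_imp_one[rotated])
  then show "a = b"
    using ab inv_equality[of a "inv b"] by (simp add: c_def)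
qed

lemma delta_bij: "bij_betw \<delta> (carrier G) (carrier G)"
  using endo_inj_surj[OF finite_carrier _ delta_inj] delta_inj
  by (auto simp: bij_betw_def)

text \<open>Take a maximal \<phi>-invariant set that omits the identity and contains no element
  together with its inverse. If it missed both \<open>x\<close> and \<open>inv x\<close> for some
  \<open>x\<close> other than the identity, the whole cycle of \<open>x\<close> could be
  added.\<close>

lemma half_system_exists:
  obtains S where "S \<subseteq> carrier G" "\<one> \<notin> S" "\<phi> ` S = S" "\<And>a. a \<in> S \<Longrightarrow> inv a \<notin> S"
    "carrier G = {\<one>} \<union> S \<union> (\<lambda>a. inv a) ` S"
proof -
  define P where "P S \<longleftrightarrow> S \<subseteq> carrier G \<and> \<one> \<notin> S \<and> (\<forall>a\<in>S. \<phi> a \<in> S) \<and> (\<forall>a\<in>S. inv a \<notin> S)" for S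
  have "finite {S. P S}"
    by (rule finite_subset[of _ "Pow (carrier G)"]) (auto simp: P_def finite_carrier)
  moreover have "{} \<in> {S. P S}"
    by (simp add: P_def)
  ultimately obtain S where "P S" and max: "\<And>T. P T \<Longrightarrow> S \<subseteq> T \<Longrightarrow> S = T"
    using finite_has_maximal[of "{S. P S}"] by blast
  then have S: "S \<subseteq> carrier G" "\<one> \<notin> S" "\<And>a. a \<in> S \<Longrightarrow> \<phi> a \<in> S" "\<And>a. a \<in> S \<Longrightarrow> inv a \<notin> S"
    by (auto simp: P_def)
  have S_iff: "\<phi> a \<in> S \<longleftrightarrow> a \<in> S" if "a \<in> carrier G" for a
    using S(3) cube[OF that] by metis
  have "x \<in> {\<one>} \<union> S \<union> (\<lambda>a. inv a) ` S" if x: "x \<in> carrier G" for x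
  proof (rule ccontr)
    assume "\<not> ?thesis"
    then have not_one: "x \<noteq> \<one>" and "x \<notin> S" and "x \<notin> (\<lambda>a. inv a) ` S"
      by auto
    then have inv_notin: "inv x \<notin> S"
      using x by (metis imageI inv_inv)
    define T where "T = {x, \<phi> x, \<phi> (\<phi> x)}"
    have T: "T \<subseteq> carrier G" "\<one> \<notin> T" "\<And>y. y \<in> T \<Longrightarrow> \<phi> y \<in> T"
      using x not_one by (auto simp: T_def eq_commute[of \<one>])
    have T_cycle: "T = {y, \<phi> y, \<phi> (\<phi> y)}" if "y \<in> T" for y
      using that x by (auto simp: T_def)
    have "inv y \<notin> S \<union> T" if "y \<in> T" for y
    proof -
      have "inv y \<notin> T"
        using eq_inv_imp_one[of y] T(1,2) T_cycle that by auto
      \<comment> \<open>Since \<phi> commutes with inversion, \<open>S_iff\<close> reduces all three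
        elements of the cycle to \<open>inv x\<close>.\<close>
      moreover have "inv y \<notin> S"
        using that inv_notin x S_iff by (auto simp: T_def inv[symmetric])
      ultimately show ?thesis by simp
    qed
    moreover have "inv y \<notin> S \<union> T" if "y \<in> S" for y
    proof -
      have "inv y \<notin> T"
      proof
        assume "inv y \<in> T"
        then have "inv (inv y) \<notin> S"
          using calculation by blast
        then show False
          using that S(1) by auto
      qed
      then show ?thesis
        using S(4)[OF that] by simp
    qed
    ultimately have "P (S \<union> T)"
      using S T by (auto simp: P_def)
    then have "T \<subseteq> S"
      using max by blast
    then show False
      using \<open>x \<notin> S\<close> by (simp add: T_def)
  qed
  then have "carrier G = {\<one>} \<union> S \<union> (\<lambda>a. inv a) ` S"
    using S(1) by auto
  moreover have "\<phi> ` S = S"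
  proof
    show "\<phi> ` S \<subseteq> S"
      using S(3) by blast
    show "S \<subseteq> \<phi> ` S"
    proof
      fix a assume "a \<in> S"
      then show "a \<in> \<phi> ` S"
        using S(1,3) by (intro image_eqI[of _ _ "\<phi> (\<phi> a)"]) auto
    qed
  qed
  ultimately show thesis
    using that S by blast
qed

section \<open>The conditions on a cubic orthomorphism\<close>

lemma cycle_type_eq:
  "cycle_type \<phi> (carrier G) = {#1#} + replicate_mset ((order G - 1) div 3) 3"
proof -
  define C where "C = orbit \<phi> ` (carrier G - {\<one>})"
  have card_C: "card c = 3" if c: "c \<in> C" for c
  proof -
    obtain a where a: "a \<in> carrier G" "a \<noteq> \<one>" "c = orbit \<phi> a"
      using c by (auto simp: C_def)
    \<comment> \<open>No element of the cycle is fixed; by \<open>cube\<close> the last inequality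
      separates \<open>a\<close> from \<open>\<phi> (\<phi> a)\<close>.\<close>
    have "\<phi> a \<noteq> a" "\<phi> (\<phi> a) \<noteq> \<phi> a" "\<phi> (\<phi> (\<phi> a)) \<noteq> \<phi> (\<phi> a)"
      using a(1,2) eq_imp_one eq_one_iff closed by metis+
    then show ?thesis
      using a by (auto simp: orbit_eq)
  qed
  have finite_C: "finite C"
    by (simp add: C_def finite_carrier)
  have Union_C: "\<Union>C = carrier G - {\<one>}"
    by (auto simp: C_def orbit_eq)
  have "3 * card C = card (\<Union>C)"
  proof (rule card_partition[OF finite_C _ card_C])
    show "finite (\<Union>C)"
      by (simp add: Union_C finite_carrier)
    fix c d assume "c \<in> C" "d \<in> C" "c \<noteq> d"
    then obtain a b where "a \<in> carrier G" "c = orbit \<phi> a" "b \<in> carrier G" "d = orbit \<phi> b"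
      by (auto simp: C_def)
    with \<open>c \<noteq> d\<close> show "c \<inter> d = {}"
      using orbit_cyclic by blast
  qed
  then have *: "card C = (order G - 1) div 3"
    using finite_carrier by (simp add: Union_C order_def card_Diff_singleton)
  \<comment> \<open>The cycle of the identity is a singleton, so it adds a new member to the set of
    cycles.\<close>
  have "orbit \<phi> \<one> \<notin> C"
    using card_C[of "orbit \<phi> \<one>"] by (auto simp: orbit_eq)
  moreover have "orbit \<phi> ` carrier G = insert (orbit \<phi> \<one>) C"
    by (auto simp: C_def)
  ultimately have "cycle_type \<phi> (carrier G) = {#1#} + image_mset card (mset_set C)"
    using finite_C by (simp add: cycle_type_def orbit_eq)
  also have "image_mset card (mset_set C) = image_mset (\<lambda>_. 3) (mset_set C)"
    using finite_C card_C by (intro image_mset_cong) auto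
  finally show ?thesis
    by (simp add: * image_mset_const_eq)
qed

text \<open>Additivity of \<phi> makes \<open>b\<close> drop out, so the first partition set is the
  same for every \<open>b\<close>.\<close>

lemma first_difference:
  assumes "a \<in> carrier G" "b \<in> carrier G"
  shows "a \<otimes> \<phi> b \<otimes> inv (\<phi> (a \<otimes> b)) = inv (\<delta> a)"
proof -
  have "a \<otimes> \<phi> b \<otimes> inv (\<phi> (a \<otimes> b)) = a \<otimes> inv (\<phi> a)"
    using assms by (simp add: mult mult_inv_mult_cancel)
  then show ?thesis
    using assms by (simp add: \<delta>_def inv_mult m_comm)
qed

lemma second_difference:
  assumes "a \<in> carrier G" "b \<in> carrier G"
  shows "\<phi> (\<phi> a) \<otimes> \<phi> b \<otimes> inv (\<phi> (a \<otimes> b)) = \<delta> (\<phi> a)"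
  using assms by (simp add: mult mult_inv_mult_cancel \<delta>_def)

text \<open>The map sends \<open>a\<close> to \<open>\<phi> b \<otimes> \<phi> (\<delta> a)\<close>,
  a composite of \<delta>, \<phi> and a translation.\<close>

lemma shift_bij:
  assumes "b \<in> carrier G"
  shows "bij_betw (\<lambda>a. \<phi> (\<phi> a) \<otimes> \<phi> (b \<otimes> inv a)) (carrier G) (carrier G)"
proof -
  have "bij_betw (\<lambda>c. \<phi> b \<otimes> c) (carrier G) (carrier G)"
    using assms by (intro bij_betw_byWitness[where f' = "\<lambda>c. inv (\<phi> b) \<otimes> c"])
      (auto simp: m_assoc[symmetric])
  then have "bij_betw ((\<lambda>c. \<phi> b \<otimes> c) \<circ> (\<phi> \<circ> \<delta>)) (carrier G) (carrier G)"
    using bij delta_bij by (blast intro: bij_betw_trans)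
  moreover have "((\<lambda>c. \<phi> b \<otimes> c) \<circ> (\<phi> \<circ> \<delta>)) a = \<phi> (\<phi> a) \<otimes> \<phi> (b \<otimes> inv a)"
    if "a \<in> carrier G" for a
    using assms that by (simp add: \<delta>_def mult m_ac)
  ultimately show ?thesis
    by (rule bij_betw_cong[THEN iffD1, rotated])
qed

theorem cubic_orthomorphism_exists:
  assumes "[order G = 1] (mod 6)"
  shows "\<exists>Gplus. cubic_orthomorphism G (order G) \<phi> Gplus"
proof -
  obtain S where S: "S \<subseteq> carrier G" "\<one> \<notin> S" "\<phi> ` S = S" "\<And>a. a \<in> S \<Longrightarrow> inv a \<notin> S"
    "carrier G = {\<one>} \<union> S \<union> (\<lambda>a. inv a) ` S"
    using half_system_exists by blast
  have disj: "\<one> \<notin> (\<lambda>a. inv a) ` S" "S \<inter> (\<lambda>a. inv a) ` S = {}"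
    using S(1,2,4) by (metis (no_types, lifting) imageE inv_eq_1_iff subset_iff, auto)
  have first: "(\<lambda>a. a \<otimes> \<phi> b \<otimes> inv (\<phi> (a \<otimes> b))) ` S = \<delta> ` (\<lambda>a. inv a) ` S"
    if "b \<in> carrier G" for b
    unfolding image_image using S(1) that
    by (intro image_cong) (auto simp: first_difference delta_inv)
  have second: "(\<lambda>a. \<phi> (\<phi> a) \<otimes> \<phi> b \<otimes> inv (\<phi> (a \<otimes> b))) ` S = \<delta> ` S"
    if "b \<in> carrier G" for b
  proof -
    have "(\<lambda>a. \<phi> (\<phi> a) \<otimes> \<phi> b \<otimes> inv (\<phi> (a \<otimes> b))) ` S = \<delta> ` \<phi> ` S"
      unfolding image_image using S(1) that
      by (intro image_cong) (auto simp: second_difference)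
    \<comment> \<open>The extra \<phi> in \<open>second_difference\<close> only permutes
      \<open>S\<close>.\<close>
    then show ?thesis
      by (simp add: S(3))
  qed
  have S_split: "(\<lambda>a. inv a) ` S \<union> S = carrier G - {\<one>}"
    using S(1,2,5) disj by auto
  have inv_S: "(\<lambda>a. inv a) ` S \<subseteq> carrier G"
    using S(1) by auto
  have Un: "\<delta> ` (\<lambda>a. inv a) ` S \<union> \<delta> ` S = carrier G - {\<one>}"
  proof -
    \<comment> \<open>Being a bijection that fixes the identity, \<delta> carries the partition of
      the nonidentity elements into inverses of \<open>S\<close> and \<open>S\<close> to another
      such partition.\<close>
    have "\<delta> ` (carrier G - {\<one>}) = \<delta> ` carrier G - \<delta> ` {\<one>}"
      using delta_inj by (intro inj_on_image_set_diff[where C = "carrier G"]) auto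
    then show ?thesis
      using delta_bij by (simp add: S_split bij_betw_def flip: image_Un)
  qed
  have Int: "\<delta> ` (\<lambda>a. inv a) ` S \<inter> \<delta> ` S = {}"
    using inj_on_image_Int[OF delta_inj inv_S S(1)] disj(2) by auto
  have "cubic_orthomorphism G (order G) \<phi> S"
  proof
    show "bij_betw (\<lambda>a. \<phi> a \<otimes> inv a) (carrier G) (carrier G)"
      using delta_bij by (simp add: \<delta>_def[abs_def])
  qed (use assms bij S disj inv cycle_type_eq cyclotomic shift_bij first second Un Int in auto)
  then show ?thesis by blast
qed

end

section \<open>Examples: cyclic groups, direct products and squares\<close>

lemma eisenstein_group_integer_mod_group:
  assumes "n > 0" "int n dvd w\<^sup>2 + w + 1"
  shows "eisenstein_group (integer_mod_group n) (\<lambda>x. w * x mod int n)"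
proof -
  interpret comm_group "integer_mod_group n" by simp
  show ?thesis
  proof
    show "(\<lambda>x. w * x mod int n) \<in> hom (integer_mod_group n) (integer_mod_group n)"
      using assms(1) by (auto simp: hom_def carrier_integer_mod_group mod_simps distrib_left)
  next
    fix x
    have "int n dvd (w\<^sup>2 + w + 1) * x"
      using assms(2) by simp
    then have "(x + w * x + w * (w * x)) mod int n = 0"
      by (simp add: algebra_simps power2_eq_square)
    then show "x \<otimes>\<^bsub>integer_mod_group n\<^esub> (w * x mod int n) \<otimes>\<^bsub>integer_mod_group n\<^esub>
        (w * (w * x mod int n) mod int n) = \<one>\<^bsub>integer_mod_group n\<^esub>"
      by (simp add: mod_simps)
  qed
qed

lemma order_integer_mod_group: "order (integer_mod_group n) = n"
  by (simp add: order_def carrier_integer_mod_group)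

lemma comm_group_DirProd:
  assumes "comm_group G" "comm_group H"
  shows "comm_group (G \<times>\<times> H)"
proof -
  interpret G: comm_group G by fact
  interpret H: comm_group H by fact
  show ?thesis
    by (intro group.group_comm_groupI DirProd_group G.is_group H.is_group)
      (auto simp: DirProd_def G.m_comm H.m_comm)
qed

lemma order_DirProd: "order (G \<times>\<times> H) = order G * order H"
  by (simp add: order_def card_cartesian_product)

lemma eisenstein_group_DirProd:
  assumes "eisenstein_group G \<phi>" "eisenstein_group H \<psi>"
  shows "eisenstein_group (G \<times>\<times> H) (map_prod \<phi> \<psi>)"
proof -
  interpret G: eisenstein_group G \<phi> by fact
  interpret H: eisenstein_group H \<psi> by fact
  interpret comm_group "G \<times>\<times> H"
    by (intro comm_group_DirProd G.comm_group_axioms H.comm_group_axioms)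
  show ?thesis
    by unfold_locales (auto simp: hom_def G.mult H.mult G.cyclotomic H.cyclotomic)
qed

text \<open>The endomorphism is the companion matrix of \<open>X\<^sup>2 + X + 1\<close>.\<close>
lemma (in comm_group) eisenstein_group_square:
  "eisenstein_group (G \<times>\<times> G) (\<lambda>(x, y). (inv y, x \<otimes> inv y))"
proof -
  interpret sq: comm_group "G \<times>\<times> G"
    by (intro comm_group_DirProd comm_group_axioms)
  show ?thesis
  proof
    show "(\<lambda>(x, y). (inv y, x \<otimes> inv y)) \<in> hom (G \<times>\<times> G) (G \<times>\<times> G)"
      by (auto simp: hom_def inv_mult m_ac)
  next
    fix a assume "a \<in> carrier (G \<times>\<times> G)"
    then obtain x y where a: "a = (x, y)" and xy: "x \<in> carrier G" "y \<in> carrier G"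
      by auto
    \<comment> \<open>This is the first coordinate of the cyclotomic relation; the second is the
      next fact with \<open>z\<close> = \<open>x \<otimes> inv y\<close>.\<close>
    have "x \<otimes> inv y \<otimes> inv (x \<otimes> inv y) = \<one>"
      using xy by (intro r_inv) auto
    moreover have "y \<otimes> z \<otimes> (inv y \<otimes> inv z) = \<one>" if "z \<in> carrier G" for z
      using r_inv[of "y \<otimes> z"] xy that by (simp add: inv_mult)
    ultimately show "a \<otimes>\<^bsub>G \<times>\<times> G\<^esub> (case a of (x, y) \<Rightarrow> (inv y, x \<otimes> inv y)) \<otimes>\<^bsub>G \<times>\<times> G\<^esub>
        (case (case a of (x, y) \<Rightarrow> (inv y, x \<otimes> inv y)) of (x, y) \<Rightarrow> (inv y, x \<otimes> inv y))
        = \<one>\<^bsub>G \<times>\<times> G\<^esub>"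
      using xy by (simp add: a)
  qed
qed

text \<open>Fixing the element type \<open>nat\<close> lets an induction over the factors stay in
  one type, although each direct product changes the type.\<close>

definition eisenstein_order :: "nat \<Rightarrow> bool" where
  "eisenstein_order q \<longleftrightarrow> (\<exists>(G :: nat monoid) \<phi>. eisenstein_group G \<phi> \<and> order G = q)"

text \<open>Transport of structure along the injection \<open>to_nat\<close>; this brings residue
  groups and groups of pairs back to \<open>nat\<close>.\<close>

lemma eisenstein_order_countable:
  fixes G :: "('a::countable, 'b) monoid_scheme"
  assumes "eisenstein_group G \<phi>"
  shows "eisenstein_order (order G)"
proof -
  interpret eisenstein_group G \<phi> by fact
  define H :: "nat monoid" where
    "H = \<lparr>carrier = to_nat ` carrier G,
          monoid.mult = \<lambda>x y. to_nat (from_nat x \<otimes>\<^bsub>G\<^esub> from_nat y :: 'a),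
          one = to_nat \<one>\<^bsub>G\<^esub>\<rparr>"
  define \<psi> :: "nat \<Rightarrow> nat" where "\<psi> x = to_nat (\<phi> (from_nat x))" for x
  have "comm_group H"
  proof (rule comm_groupI)
    fix x assume "x \<in> carrier H"
    then obtain a where "a \<in> carrier G" "x = to_nat a"
      by (auto simp: H_def)
    then show "\<exists>y\<in>carrier H. y \<otimes>\<^bsub>H\<^esub> x = \<one>\<^bsub>H\<^esub>"
      by (intro bexI[of _ "to_nat (inv\<^bsub>G\<^esub> a)"]) (auto simp: H_def)
  qed (auto simp: H_def m_ac)
  then interpret H: comm_group H .
  have "eisenstein_group H \<psi>"
    by unfold_locales (auto simp: H_def \<psi>_def hom_def mult cyclotomic)
  moreover have "order H = order G"
    by (simp add: order_def H_def card_image)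
  ultimately show ?thesis
    by (auto simp: eisenstein_order_def)
qed

section \<open>Orders that occur: closure under products, squares and prime powers\<close>

lemma eisenstein_order_dvd:
  assumes "n > 0" "int n dvd w\<^sup>2 + w + 1"
  shows "eisenstein_order n"
  using eisenstein_order_countable[OF eisenstein_group_integer_mod_group[OF assms]]
  by (simp add: order_integer_mod_group)

lemma eisenstein_order_1: "eisenstein_order 1"
  by (rule eisenstein_order_dvd[of _ 0]) auto

lemma eisenstein_order_mult:
  "eisenstein_order m \<Longrightarrow> eisenstein_order n \<Longrightarrow> eisenstein_order (m * n)"
  using eisenstein_order_countable[OF eisenstein_group_DirProd]
  unfolding eisenstein_order_def[of m] eisenstein_order_def[of n] by (auto simp: order_DirProd)

lemma eisenstein_order_power: "eisenstein_order n \<Longrightarrow> eisenstein_order (n ^ k)"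
  by (induction k) (simp_all add: eisenstein_order_mult eisenstein_order_1 del: One_nat_def)

lemma eisenstein_order_square: "eisenstein_order (n\<^sup>2)"
  using eisenstein_order_countable[OF comm_group.eisenstein_group_square[OF abelian_integer_mod_group]]
  by (simp add: order_DirProd order_integer_mod_group power2_eq_square)

text \<open>With \<open>p - 1 = 3 * k\<close> and a primitive root \<open>g\<close>, the power
  \<open>g ^ k\<close> has order 3 modulo \<open>p\<close>. So \<open>p\<close> divides w^3 - 1 = (w
  - 1)(w^2 + w + 1) for w = \<open>g ^ k\<close>, but not the first factor.\<close>

lemma prime_cube_root_of_unity:
  fixes p :: nat
  assumes "Factorial_Ring.prime p" "[p = 1] (mod 3)"
  obtains w :: int where "int p dvd w\<^sup>2 + w + 1"
proof -
  have p: "p > 1"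
    using assms(1) prime_gt_1_nat by blast
  obtain k where k: "p - 1 = 3 * k"
    using assms(2) p by (metis cong_altdef_nat dvdE less_imp_le)
  then have "k > 0"
    using p by (cases k) auto
  obtain g where "residue_primroot p g"
    using prime_primitive_root_exists[OF p] assms(1) by auto
  then have ord_g: "ord p g = 3 * k"
    using assms(1) k by (simp add: residue_primroot_def totient_prime)
  have "[g ^ (3 * k) = 1] (mod p)"
    using ord_divides[of g "3 * k" p] ord_g by simp
  then have "[int (g ^ (3 * k)) = int 1] (mod int p)"
    by (simp only: cong_int_iff)
  then have "int p dvd int (g ^ k) ^ 3 - 1"
    by (simp add: cong_iff_dvd_diff mult.commute power_mult)
  also have "int (g ^ k) ^ 3 - 1 = (int (g ^ k) - 1) * ((int (g ^ k))\<^sup>2 + int (g ^ k) + 1)"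
    by (simp add: algebra_simps power2_eq_square power3_eq_cube)
  finally have "int p dvd int (g ^ k) - 1 \<or> int p dvd (int (g ^ k))\<^sup>2 + int (g ^ k) + 1"
    using assms(1) by (simp add: prime_dvd_mult_iff)
  moreover have "\<not> int p dvd int (g ^ k) - 1"
  proof
    assume "int p dvd int (g ^ k) - 1"
    then have "[int (g ^ k) = int 1] (mod int p)"
      by (simp add: cong_iff_dvd_diff)
    then have "ord p g dvd k"
      by (simp only: cong_int_iff ord_divides)
    then show False
      using \<open>k > 0\<close> by (auto simp: ord_g dest: dvd_imp_le)
  qed
  ultimately show thesis
    using that by blast
qed

text \<open>If \<open>p\<close> is 1 modulo 3, a direct power of the cyclic group of order
  \<open>p\<close> serves. If \<open>p\<close> is 2 modulo 3, its odd powers are 2 modulo 3, so the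
  exponent is even and the square construction applies.\<close>

lemma eisenstein_order_primepow:
  assumes "primepow q" "[q = 1] (mod 3)"
  shows "eisenstein_order q"
proof -
  obtain p k where p: "Factorial_Ring.prime p" "k > 0" "q = p ^ k"
    using assms(1) by (auto simp: primepow_def)
  have "p mod 3 \<noteq> 0"
  proof
    assume "p mod 3 = 0"
    then have "3 dvd q"
      using p(2,3) dvd_trans[of 3 p q] by auto
    then show False
      using assms(2) by (auto simp: cong_def)
  qed
  then consider "[p = 1] (mod 3)" | "[p = 2] (mod 3)"
    unfolding cong_def by fastforce
  then show ?thesis
  proof cases
    case 1
    then obtain w :: int where "int p dvd w\<^sup>2 + w + 1"
      using prime_cube_root_of_unity p(1) by blast
    then have "eisenstein_order p"
      using p(1) by (intro eisenstein_order_dvd) (auto simp: prime_gt_0_nat)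
    then show ?thesis
      by (simp add: p(3) eisenstein_order_power)
  next
    case 2
    have "even k"
    proof (rule ccontr)
      assume "odd k"
      then obtain j where j: "k = 2 * j + 1"
        by (elim oddE)
      have "[p\<^sup>2 = 2\<^sup>2] (mod 3)"
        using 2 by (rule cong_pow)
      then have "[p\<^sup>2 = 1] (mod 3)"
        by (simp add: cong_def)
      then have "[(p\<^sup>2) ^ j * p = 1 ^ j * 2] (mod 3)"
        using 2 by (intro cong_mult cong_pow)
      moreover have "q = (p\<^sup>2) ^ j * p"
        by (simp add: p(3) j power_mult)
      ultimately have "[q = 2] (mod 3)"
        by simp
      then show False
        using assms(2) by (simp add: cong_def)
    qed
    then obtain j where "k = 2 * j" by (elim evenE)
    then have "q = (p ^ j)\<^sup>2"
      by (simp add: p(3) power_mult mult.commute)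
    then show ?thesis
      by (simp add: eisenstein_order_square)
  qed
qed

theorem corollary2p3:
  fixes I :: "'i set" and qi :: "'i \<Rightarrow> nat" and q :: nat
  assumes "finite I"
    and "\<And>i. i \<in> I \<Longrightarrow> primepow (qi i)"
    and "\<And>i. i \<in> I \<Longrightarrow> [qi i = 1] (mod 6)"
    and "q = (\<Prod>i\<in>I. qi i)"
  shows "\<exists>(G :: nat monoid) f Gplus. cubic_orthomorphism G q f Gplus"
proof -
  have "eisenstein_order (qi i)" if "i \<in> I" for i
    using assms(2,3)[OF that] cong_modulus_mult_nat[of "qi i" 1 3 2]
    by (intro eisenstein_order_primepow) auto
  with assms(1) have "eisenstein_order (\<Prod>i\<in>I. qi i)"
    by (induction I rule: finite_induct)
      (simp_all add: eisenstein_order_mult eisenstein_order_1 del: One_nat_def)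
  then obtain G :: "nat monoid" and \<phi> where G: "eisenstein_group G \<phi>" "order G = q"
    by (auto simp: assms(4) eisenstein_order_def)
  interpret eisenstein_group G \<phi> by fact
  \<comment> \<open>The congruence for the whole product gives both coprimality to 6 and the
    congruence required of the order.\<close>
  have "[(\<Prod>i\<in>I. qi i) = (\<Prod>i\<in>I. 1)] (mod 6)"
    using assms(3) by (intro cong_prod)
  then have q: "[order G = 1] (mod 6)"
    by (simp add: assms(4) G(2))
  then have "coprime 6 (order G)"
    using cong_imp_coprime[OF cong_sym] coprime_commute by (metis coprime_1_left)
  then interpret eisenstein_group_coprime_6 G \<phi>
    by unfold_locales
  show ?thesis
    using cubic_orthomorphism_exists[OF q] G(2) by blast
qed

end
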